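(* Let $d\ge 1$ and let $\mathcal{F}$ be a family of nonempty compact convex sets in $\mathbb{R}^d$. If among every $\aleph_0$ members of $\mathcal{F}$ some $d+1$ can be hit by a hyperplane, then all the members of $\mathcal{F}$ can be hit by finitely many hyperplanes.
   Context: A hyperplane (a $(d-1)$-dimensional affine subspace of $\mathbb{R}^d$) hits a set if it intersects it. The hypothesis means that every infinite subfamily of $\mathcal{F}$ contains $d+1$ distinct members that are all intersected by one common hyperplane. The conclusion means that there is a finite set of hyperplanes such that each member of $\mathcal{F}$ is intersected by at least one of them. *)

theory Defs
  imports "HOL-Analysis.Analysis"
begin

definition hyperplane :: "'a::euclidean_space set \<Rightarrow> bool" where
  "hyperplane H \<longleftrightarrow> affine H \<and> aff_dim H = int DIM('a) - 1"

definition hits :: "'a set \<Rightarrow> 'a set \<Rightarrow> bool" where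
  "hits H X \<longleftrightarrow> H \<inter> X \<noteq> {}"

end

theory Submission
  imports Defs
begin

text \<open>
  Identify an affine functional on \<open>\<real>\<^sup>d\<close> with a vector \<open>v\<close> of \<open>\<real>\<^sup>d \<times> \<real>\<close>, its value at
  \<open>x\<close> being \<open>v \<bullet> (x, 1)\<close>. Suppose that \<open>F\<close> is not hit by finitely many hyperplanes. A set that
  misses a hyperplane lies strictly on one side of it, so by Zorn's lemma one can choose a sign for
  every nonzero functional such that any finitely many of the choices are realised
  simultaneously on some member of \<open>F\<close>. The positive functionals form a total order on the dual space,
  which is lexicographic: there is a basis \<open>u\<^sub>0, \<dots>, u\<^sub>d\<close> such that every \<open>u\<^sub>i\<close> and every
  \<open>\<epsilon> u\<^sub>i - u\<^sub>i\<^sub>+\<^sub>1\<close> is positive. So for every \<open>\<epsilon>\<close> some member of \<open>F\<close> has, at all of its points,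
  positive coordinates each at most \<open>\<epsilon>\<close> times the preceding one. Choosing members \<open>X\<^sub>0, X\<^sub>1, \<dots>\<close>
  with \<open>\<epsilon>\<close> decreasing fast compared to the (compact) earlier members, points of any \<open>d + 1\<close> of
  them form a matrix dominated by its antidiagonal, so that no hyperplane contains all of them.
\<close>

section \<open>Families hit by finitely many hyperplanes\<close>

definition finitely_hit :: "'a::euclidean_space set set \<Rightarrow> bool" where
  "finitely_hit F \<longleftrightarrow>
    (\<exists>\<H>. finite \<H> \<and> (\<forall>H\<in>\<H>. hyperplane H) \<and> (\<forall>X\<in>F. \<exists>H\<in>\<H>. hits H X))"

lemma finitely_hit_empty: "finitely_hit {}"
  unfolding finitely_hit_def by blast

lemma finitely_hit_mono: "finitely_hit G \<Longrightarrow> F \<subseteq> G \<Longrightarrow> finitely_hit F"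
  unfolding finitely_hit_def by blast

lemma finitely_hit_Un:
  assumes "finitely_hit F" "finitely_hit G"
  shows "finitely_hit (F \<union> G)"
proof -
  obtain A B where "finite A" "\<forall>H\<in>A. hyperplane H" "\<forall>X\<in>F. \<exists>H\<in>A. hits H X"
    "finite B" "\<forall>H\<in>B. hyperplane H" "\<forall>X\<in>G. \<exists>H\<in>B. hits H X"
    using assms unfolding finitely_hit_def by blast
  then show ?thesis
    unfolding finitely_hit_def by (intro exI[of _ "A \<union> B"]) blast
qed

section \<open>Signs of affine functionals on convex sets\<close>

definition positive_on :: "'a::euclidean_space \<times> real \<Rightarrow> 'a set \<Rightarrow> bool" where
  "positive_on v X \<longleftrightarrow> (\<forall>x\<in>X. 0 < v \<bullet> (x, 1))"

lemma convex_sign_or_zero: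
  fixes v :: "'a::euclidean_space \<times> real"
  assumes "convex X"
  shows "positive_on v X \<or> positive_on (- v) X \<or> (\<exists>x\<in>X. v \<bullet> (x, 1) = 0)"
proof (rule ccontr)
  assume "\<not> ?thesis"
  then obtain x y where xy: "x \<in> X" "y \<in> X" "v \<bullet> (x, 1) \<le> 0" "0 \<le> v \<bullet> (y, 1)"
      and nz: "\<forall>x\<in>X. v \<bullet> (x, 1) \<noteq> 0"
    unfolding positive_on_def by (auto simp: not_less)
  have "connected ((\<lambda>x. v \<bullet> (x, 1)) ` X)"
    by (intro connected_continuous_image continuous_intros convex_connected assms)
  then have "0 \<in> (\<lambda>x. v \<bullet> (x, 1)) ` X"
    using xy by (auto intro: connectedD_interval)
  then show False
    using nz by auto
qed

lemma hyperplane_zero_set: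
  fixes v :: "'a::euclidean_space \<times> real"
  assumes "fst v \<noteq> 0"
  shows "hyperplane {x. v \<bullet> (x, 1) = 0}"
proof -
  have "{x. v \<bullet> (x, 1) = 0} = {x. fst v \<bullet> x = - snd v}"
    by (auto simp: inner_prod_def)
  then show ?thesis
    unfolding hyperplane_def using assms by (simp add: affine_hyperplane aff_dim_hyperplane)
qed

lemma hyperplane_as_zero_set:
  fixes H :: "'a::euclidean_space set"
  assumes "hyperplane H"
  obtains v :: "'a \<times> real" where "v \<noteq> 0" "H = {x. v \<bullet> (x, 1) = 0}"
proof -
  obtain a b where ab: "a \<noteq> 0" "affine hull H = {x. a \<bullet> x = b}"
    using assms aff_dim_eq_hyperplane[of H] unfolding hyperplane_def by auto
  moreover have "affine hull H = H"
    using assms unfolding hyperplane_def by (simp add: affine_hull_eq)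
  ultimately have "H = {x. (a, - b) \<bullet> (x, 1) = 0}"
    by (auto simp: inner_prod_def)
  with ab(1) that[of "(a, - b)"] show ?thesis
    by (simp add: zero_prod_def)
qed

lemma finitely_hit_zero:
  fixes v :: "'a::euclidean_space \<times> real"
  assumes "v \<noteq> 0"
  shows "finitely_hit {X. \<exists>x\<in>X. v \<bullet> (x, 1) = 0}"
\<comment> \<open>With vanishing linear part the functional is a nonzero constant and has no zeros;
  otherwise its zero set is one hyperplane.\<close>
proof (cases "fst v = 0")
  case True
  then have "{X. \<exists>x\<in>X. v \<bullet> (x, 1) = 0} = {}"
    using assms by (auto simp: inner_prod_def prod_eq_iff)
  then show ?thesis
    by (simp add: finitely_hit_empty)
next
  case False
  show ?thesis
    unfolding finitely_hit_def
    using hyperplane_zero_set[OF False]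
    by (intro exI[of _ "{{x. v \<bullet> (x, 1) = 0}}"]) (auto simp: hits_def)
qed

section \<open>A total cone of functionals by Zorn's lemma\<close>

text \<open>Finitely hit families form an ideal of small families. The cone is a maximal set of
  functionals each of whose finite parts is positive on a family that is not small.\<close>

lemma positive_cone_exists:
  fixes F :: "'a::euclidean_space set set"
  assumes mem: "\<forall>X\<in>F. X \<noteq> {} \<and> convex X"
    and nhit: "\<not> finitely_hit F"
  shows "\<exists>P :: ('a \<times> real) set. convex P \<and> 0 \<notin> P \<and> (\<forall>v. v \<noteq> 0 \<longrightarrow> v \<in> P \<or> - v \<in> P) \<and>
    (\<forall>E. finite E \<longrightarrow> E \<subseteq> P \<longrightarrow> (\<exists>X\<in>F. \<forall>v\<in>E. positive_on v X))"
proof -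
  define sub where "sub E = {X\<in>F. \<forall>v\<in>E. positive_on v X}" for E :: "('a \<times> real) set"
  \<comment> \<open>Asking that \<open>sub E\<close> be not finitely hit, rather than merely
    nonempty, is what allows a sign to be chosen for every further functional.\<close>
  define \<C> where "\<C> = {Q. \<forall>E. finite E \<and> E \<subseteq> Q \<longrightarrow> \<not> finitely_hit (sub E)}"
  have "{} \<in> \<C>"
    using nhit by (simp add: \<C>_def sub_def)
  then have "\<C> \<noteq> {}"
    by blast
  moreover have "\<Union>K \<in> \<C>" if K: "K \<noteq> {}" "subset.chain \<C> K" for K
    unfolding \<C>_def
  proof (intro CollectI allI impI)
    fix E assume E: "finite E \<and> E \<subseteq> \<Union>K"
    then obtain Q where "Q \<in> K" "E \<subseteq> Q"
      using finite_subset_Union_chain[of E K \<C>] K by blast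
    then show "\<not> finitely_hit (sub E)"
      using K(2) E unfolding subset.chain_def \<C>_def by blast
  qed
  ultimately obtain P where P: "P \<in> \<C>" and max: "\<And>Q. Q \<in> \<C> \<Longrightarrow> P \<subseteq> Q \<Longrightarrow> Q = P"
    using subset_Zorn_nonempty[of \<C>] by metis
  have nsmall: "\<not> finitely_hit (sub E)" if "finite E" "E \<subseteq> P" for E
    using P that by (simp add: \<C>_def)
  have real: "\<exists>X\<in>F. \<forall>v\<in>E. positive_on v X" if "finite E" "E \<subseteq> P" for E
  proof -
    have "sub E \<noteq> {}"
      using nsmall[OF that] finitely_hit_empty by metis
    then show ?thesis
      by (auto simp: sub_def)
  qed
  have extend: "\<exists>E. finite E \<and> E \<subseteq> P \<and> finitely_hit (sub (insert v E))" if "v \<notin> P" for v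
  proof -
    have "insert v P \<notin> \<C>"
      using max[of "insert v P"] that by blast
    then obtain E where E: "finite E" "E \<subseteq> insert v P" "finitely_hit (sub E)"
      by (auto simp: \<C>_def)
    have "sub (insert v (E - {v})) \<subseteq> sub E"
      by (auto simp: sub_def)
    then show ?thesis
      using E by (intro exI[of _ "E - {v}"]) (auto intro: finitely_hit_mono)
  qed
  have total: "v \<in> P \<or> - v \<in> P" if "v \<noteq> 0" for v
  proof (rule ccontr)
    assume "\<not> ?thesis"
    then obtain A B where A: "finite A" "A \<subseteq> P" "finitely_hit (sub (insert v A))"
      and B: "finite B" "B \<subseteq> P" "finitely_hit (sub (insert (- v) B))"
      using extend by meson
    \<comment> \<open>If both signs were rejected, three finitely hit families would cover
      \<open>sub (A \<union> B)\<close>: \<open>v\<close> positive, \<open>v\<close> negative,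
      \<open>v\<close> with a zero.\<close>
    have "sub (A \<union> B) \<subseteq> sub (insert v A) \<union> sub (insert (- v) B) \<union> {X. \<exists>x\<in>X. v \<bullet> (x, 1) = 0}"
      using convex_sign_or_zero[of _ v] mem by (auto simp: sub_def)
    then have "finitely_hit (sub (A \<union> B))"
      by (rule finitely_hit_mono[rotated]) (intro finitely_hit_Un A B finitely_hit_zero that)
    then show False
      using nsmall[of "A \<union> B"] A B by simp
  qed
  have zero: "0 \<notin> P"
  proof
    assume "0 \<in> P"
    then obtain X where "X \<in> F" "positive_on 0 X"
      using real[of "{0}"] by auto
    then show False
      using mem by (auto simp: positive_on_def)
  qed
  have "convex P"
  proof (rule convexI)
    fix v w and s t :: real
    assume *: "v \<in> P" "w \<in> P" "0 \<le> s" "0 \<le> t" "s + t = 1"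
    let ?z = "s *\<^sub>R v + t *\<^sub>R w"
    show "?z \<in> P"
    proof (rule ccontr)
      assume nz: "?z \<notin> P"
      \<comment> \<open>At a point where \<open>v\<close> and \<open>w\<close> are positive,
        \<open>?z\<close> is positive too. This is absurd if \<open>?z = 0\<close>, and otherwise
        totality yields a member on which \<open>- ?z\<close> is positive as well.\<close>
      have "\<exists>X\<in>F. positive_on v X \<and> positive_on w X \<and> (?z = 0 \<or> positive_on (- ?z) X)"
      proof (cases "?z = 0")
        case True
        then show ?thesis
          using real[of "{v, w}"] * by auto
      next
        case False
        then have "- ?z \<in> P"
          using total nz by blast
        then show ?thesis
          using real[of "{v, w, - ?z}"] * by auto
      qed
      then obtain X where X: "X \<in> F" "positive_on v X" "positive_on w X"
          "?z = 0 \<or> positive_on (- ?z) X"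
        by blast
      obtain x where x: "x \<in> X"
        using mem X(1) by blast
      have "0 < s * (v \<bullet> (x, 1)) + t * (w \<bullet> (x, 1))"
      proof (cases "s = 0")
        case False
        then have "0 < s * (v \<bullet> (x, 1))" "0 \<le> t * (w \<bullet> (x, 1))"
          using X x * by (auto simp: positive_on_def less_imp_le)
        then show ?thesis
          by simp
      qed (use X x * in \<open>auto simp: positive_on_def\<close>)
      then have "0 < ?z \<bullet> (x, 1)"
        by (simp only: inner_add_left inner_scaleR_left)
      moreover have "?z \<bullet> (x, 1) \<le> 0"
        using X(4)
      proof
        assume "positive_on (- ?z) X"
        then have "0 < (- ?z) \<bullet> (x, 1)"
          using x by (simp only: positive_on_def)
        then show ?thesis
          by (simp only: inner_minus_left)
      qed (simp only: inner_zero_left order_refl)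
      ultimately show False
        by simp
    qed
  qed
  with zero total real show ?thesis
    by blast
qed

section \<open>Lexicographic structure of the cone\<close>

text \<open>Induction on the dimension: a unit vector \<open>b\<close> separating 0 from the cone
  decides the sign of every vector of \<open>S\<close> not orthogonal to it, and the ties are left
  to the orthogonal complement. The resulting \<open>u\<close> is orthonormal, whence the
  expansion.\<close>

lemma lexicographic_basis:
  fixes P S :: "'a::euclidean_space set"
  assumes P: "convex P" "0 \<notin> P" "\<And>v. v \<noteq> 0 \<Longrightarrow> v \<in> P \<or> - v \<in> P"
    and "subspace S" "dim S = n"
  shows "\<exists>u. (\<forall>i<n. u i \<in> S \<and> u i \<in> P)
    \<and> (\<forall>i \<epsilon>. Suc i < n \<longrightarrow> 0 < \<epsilon> \<longrightarrow> \<epsilon> *\<^sub>R u i - u (Suc i) \<in> P)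
    \<and> (\<forall>v\<in>S. v = (\<Sum>i<n. (u i \<bullet> v) *\<^sub>R u i))"
  using assms(4,5)
proof (induction n arbitrary: S)
  case 0
  then have "S \<subseteq> {0}"
    by (simp add: dim_eq_0)
  then show ?case
    by auto
next
  case (Suc n)
  obtain w where "w \<in> S" "w \<noteq> 0"
    using Suc.prems(2) dim_eq_0[of S] by auto
  then have "S \<inter> P \<noteq> {}"
    using P(3)[of w] subspace_neg[OF Suc.prems(1)] by blast
  moreover have "convex (S \<inter> P)"
    by (intro convex_Int subspace_imp_convex Suc.prems P)
  moreover have "0 \<notin> S \<inter> P"
    using P(2) by simp
  \<comment> \<open>The separating vector is taken in the span of \<open>S \<inter> P\<close> so
    that it lies in \<open>S\<close>.\<close>
  ultimately obtain a where a: "a \<in> span (S \<inter> P)" "a \<noteq> 0" "\<And>x. x \<in> S \<inter> P \<Longrightarrow> 0 \<le> a \<bullet> x"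
    using separating_hyperplane_set_0_inspan[of "S \<inter> P" thesis] by meson
  define b where "b = a /\<^sub>R norm a"
  have "a \<in> S"
    using a(1) span_mono[of "S \<inter> P" S] span_eq_iff Suc.prems(1) by blast
  then have bS: "b \<in> S"
    unfolding b_def by (intro subspace_scale Suc.prems)
  have bb: "b \<bullet> b = 1"
    using a(2) by (simp add: b_def dot_square_norm power2_eq_square)
  have pos: "v \<in> P" if "v \<in> S" "0 < b \<bullet> v" for v
  proof (rule ccontr)
    assume "v \<notin> P"
    moreover have "v \<noteq> 0"
      using that by auto
    ultimately have "- v \<in> S \<inter> P"
      using P(3) that subspace_neg[OF Suc.prems(1)] by blast
    then have "0 \<le> a \<bullet> (- v)"
      by (rule a(3))
    then show False
      using that a(2) by (simp add: b_def zero_less_mult_iff)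
  qed
  define T where "T = {y\<in>S. \<forall>x\<in>span {b}. orthogonal x y}"
  have Tiff: "y \<in> T \<longleftrightarrow> y \<in> S \<and> b \<bullet> y = 0" for y
    by (auto simp: T_def span_singleton orthogonal_def)
  have "subspace T"
    using Suc.prems(1) unfolding subspace_def
    by (auto simp: Tiff inner_add_right)
  moreover have "dim T = n"
  proof -
    have "b \<noteq> 0"
      using bb by auto
    then have "dim (span {b}) = 1"
      using dim_singleton[of b] by simp
    moreover have "span {b} \<subseteq> S"
      using bS Suc.prems(1) by (simp add: span_minimal)
    ultimately show ?thesis
      using dim_subspace_orthogonal_to_vectors[of "span {b}" S] Suc.prems
      by (simp add: T_def)
  qed
  ultimately obtain u where u: "\<forall>i<n. u i \<in> T \<and> u i \<in> P"
      "\<forall>i \<epsilon>. Suc i < n \<longrightarrow> 0 < \<epsilon> \<longrightarrow> \<epsilon> *\<^sub>R u i - u (Suc i) \<in> P"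
      "\<forall>v\<in>T. v = (\<Sum>i<n. (u i \<bullet> v) *\<^sub>R u i)"
    using Suc.IH by blast
  \<comment> \<open>\<open>b\<close> takes index 0 because it dominates:
    \<open>b \<bullet> (\<epsilon> *\<^sub>R b - u 0) = \<epsilon>\<close> is positive however small
    \<open>\<epsilon>\<close> is.\<close>
  let ?u = "case_nat b u"
  show ?case
  proof (intro exI[of _ ?u] conjI allI impI ballI)
    fix i assume "i < Suc n"
    then show "?u i \<in> S" "?u i \<in> P"
      using u(1) bS pos[of b] bb by (auto simp: Tiff split: nat.split)
  next
    fix i and \<epsilon> :: real assume i: "Suc i < Suc n" "0 < \<epsilon>"
    show "\<epsilon> *\<^sub>R ?u i - ?u (Suc i) \<in> P"
    proof (cases i)
      case 0
      have "u 0 \<in> S" "b \<bullet> u 0 = 0"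
        using u(1) i 0 by (auto simp: Tiff)
      then show ?thesis
        using 0 i bb bS Suc.prems(1)
        by (auto intro!: pos subspace_diff subspace_scale simp: inner_diff_right)
    next
      case (Suc k)
      then show ?thesis
        using u(2) i by simp
    qed
  next
    fix v assume v: "v \<in> S"
    define z where "z = v - (b \<bullet> v) *\<^sub>R b"
    have "z \<in> T"
      using v bS bb Suc.prems(1)
      by (auto simp: Tiff z_def inner_diff_right intro!: subspace_diff subspace_scale)
    then have "z = (\<Sum>i<n. (u i \<bullet> z) *\<^sub>R u i)"
      using u(3) by blast
    also have "\<dots> = (\<Sum>i<n. (u i \<bullet> v) *\<^sub>R u i)"
    proof (rule sum.cong)
      fix i assume "i \<in> {..<n}"
      then have "b \<bullet> u i = 0"
        using u(1) by (auto simp: Tiff)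
      then show "(u i \<bullet> z) *\<^sub>R u i = (u i \<bullet> v) *\<^sub>R u i"
        by (simp add: z_def inner_diff_right inner_commute)
    qed simp
    finally show "v = (\<Sum>i<Suc n. (?u i \<bullet> v) *\<^sub>R ?u i)"
      by (simp add: z_def sum.lessThan_Suc_shift algebra_simps del: sum.lessThan_Suc)
  qed
qed

section \<open>Estimates for coefficients and coordinates\<close>

text \<open>The row of \<open>y i\<close> controls the coefficient \<open>\<alpha> i\<close>: earlier coefficients are at most \<open>\<eta>' A\<close> by the
  rows already treated, later ones are multiplied by the small ratio \<open>\<epsilon>\<close>.\<close>
lemma coefficient_bound:
  fixes \<alpha> y :: "nat \<Rightarrow> real"
  assumes rel: "(\<Sum>l<n. \<alpha> l * y l) = 0" and i: "i < n"
    and pos: "0 < y i" "\<And>l. l < n \<Longrightarrow> 0 \<le> y l"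
    and before: "\<And>l. l < i \<Longrightarrow> \<bar>\<alpha> l\<bar> \<le> \<eta>' * A \<and> y l \<le> M * y i"
    and after: "\<And>l. i < l \<Longrightarrow> l < n \<Longrightarrow> \<bar>\<alpha> l\<bar> \<le> A \<and> y l \<le> \<epsilon> * y i"
    and nonneg: "0 \<le> \<eta>'" "0 \<le> A" "0 \<le> M" "0 \<le> \<epsilon>"
  shows "\<bar>\<alpha> i\<bar> \<le> real n * (M * \<eta>' + \<epsilon>) * A"
proof -
  let ?B = "(M * \<eta>' + \<epsilon>) * A * y i"
  have B: "0 \<le> ?B"
    using nonneg pos by simp
  have bound: "\<bar>\<alpha> l * y l\<bar> \<le> ?B" if l: "l \<in> {..<n} - {i}" for l
  proof (cases "l < i")
    case True
    then have "\<bar>\<alpha> l\<bar> * y l \<le> (\<eta>' * A) * (M * y i)"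
      using before[OF True] pos l nonneg by (intro mult_mono) auto
    also have "\<dots> \<le> ?B"
      using nonneg pos by (simp add: algebra_simps)
    finally show ?thesis
      using pos l by (simp add: abs_mult)
  next
    case False
    then have "\<bar>\<alpha> l\<bar> * y l \<le> A * (\<epsilon> * y i)"
      using after[of l] pos l nonneg by (intro mult_mono) auto
    also have "\<dots> \<le> ?B"
      using nonneg pos by (simp add: algebra_simps)
    finally show ?thesis
      using pos l by (simp add: abs_mult)
  qed
  have "\<alpha> i * y i = - (\<Sum>l\<in>{..<n} - {i}. \<alpha> l * y l)"
    using rel i by (simp add: sum.remove[of "{..<n}" i])
  then have "\<bar>\<alpha> i\<bar> * y i \<le> (\<Sum>l\<in>{..<n} - {i}. \<bar>\<alpha> l * y l\<bar>)"
    using pos(1) sum_abs[of "\<lambda>l. \<alpha> l * y l" "{..<n} - {i}"] abs_mult[of "\<alpha> i" "y i"]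
    by (simp only: abs_minus_cancel abs_of_pos)
  also have "\<dots> \<le> (\<Sum>l\<in>{..<n} - {i}. ?B)"
    by (intro sum_mono bound)
  also have "\<dots> = real (n - 1) * ?B"
    using i by simp
  also have "\<dots> \<le> real n * ?B"
    using B by (intro mult_right_mono) auto
  finally have "\<bar>\<alpha> i\<bar> * y i \<le> (real n * (M * \<eta>' + \<epsilon>) * A) * y i"
    by (simp add: algebra_simps)
  then show ?thesis
    using pos(1) mult_le_cancel_right_pos by blast
qed

text \<open>Every step from \<open>i\<close> to \<open>l\<close> contributes a factor
  \<open>\<epsilon> \<le> 1\<close>; one factor is kept and the others are dropped.\<close>

lemma geometric_decay:
  fixes y :: "nat \<Rightarrow> real"
  assumes "\<And>l. l < n \<Longrightarrow> 0 < y l" "\<And>l. Suc l < n \<Longrightarrow> y (Suc l) \<le> \<epsilon> * y l" "\<epsilon> \<le> 1" "i < l" "l < n"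
  shows "y l \<le> \<epsilon> * y i"
  using assms(4,5)
proof (induction l rule: less_induct)
  case (less l)
  then obtain k where k: "l = Suc k"
    using not0_implies_Suc by force
  have le: "y l \<le> \<epsilon> * y k"
    using assms(2) less.prems k by simp
  show ?case
  proof (cases "k = i")
    case False
    then have "y k \<le> \<epsilon> * y i"
      using less k by auto
    moreover have "0 < y k" "0 < y l" "0 < y i"
      using less.prems k assms(1) by auto
    moreover have "\<epsilon> * y k \<le> 1 * y k"
      using \<open>0 < y k\<close> assms(3) by (intro mult_right_mono) auto
    ultimately show ?thesis
      using le by simp
  qed (use le in simp)
qed

text \<open>Quotients of positive continuous functions are bounded on a compact set, and there are
  finitely many pairs. This is where compactness of the members enters.\<close>

lemma compact_ratio_bound:
  fixes g :: "nat \<Rightarrow> 'a::topological_space \<Rightarrow> real"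
  assumes "compact X" "\<And>i. i < n \<Longrightarrow> continuous_on X (g i)" "\<And>i x. i < n \<Longrightarrow> x \<in> X \<Longrightarrow> 0 < g i x"
  shows "\<exists>M\<ge>1. \<forall>x\<in>X. \<forall>i<n. \<forall>l<n. g l x \<le> M * g i x"
proof -
  have "\<exists>b. \<forall>x\<in>X. g l x / g i x \<le> b" if "i < n" "l < n" for i l
  proof -
    have "continuous_on X (\<lambda>x. g l x / g i x)"
      using assms that by (intro continuous_intros) force+
    then have "bounded ((\<lambda>x. g l x / g i x) ` X)"
      using assms(1) compact_continuous_image compact_imp_bounded by blast
    then show ?thesis
      unfolding bounded_iff by (force simp: abs_le_iff)
  qed
  then obtain b where b: "\<And>i l x. i < n \<Longrightarrow> l < n \<Longrightarrow> x \<in> X \<Longrightarrow> g l x / g i x \<le> b i l"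
    by metis
  define M where "M = 1 + (\<Sum>i<n. \<Sum>l<n. \<bar>b i l\<bar>)"
  have "g l x \<le> M * g i x" if "x \<in> X" "i < n" "l < n" for i l x
  proof -
    have "b i l \<le> \<bar>b i l\<bar>"
      by simp
    also have "\<dots> \<le> (\<Sum>l<n. \<bar>b i l\<bar>)"
      using that by (intro member_le_sum) auto
    also have "\<dots> \<le> (\<Sum>i<n. \<Sum>l<n. \<bar>b i l\<bar>)"
      using that by (intro member_le_sum[where f = "\<lambda>i. \<Sum>l<n. \<bar>b i l\<bar>"]) (auto intro: sum_nonneg)
    finally have "g l x / g i x \<le> M"
      using b[OF that(2,3,1)] by (simp add: M_def)
    then show ?thesis
      using assms(3)[OF that(2,1)] by (simp add: divide_le_eq)
  qed
  moreover have "1 \<le> M"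
    by (simp add: M_def sum_nonneg)
  ultimately show ?thesis
    by blast
qed

section \<open>Members with rapidly decaying coordinates\<close>

theorem corollary6:
  fixes F :: "(real ^ 'd) set set"
  assumes members: "\<And>X. X \<in> F \<Longrightarrow> X \<noteq> {} \<and> compact X \<and> convex X"
    and aleph0: "\<And>G. G \<subseteq> F \<Longrightarrow> infinite G \<Longrightarrow>
      \<exists>S H. S \<subseteq> G \<and> card S = CARD('d) + 1 \<and> hyperplane H \<and> (\<forall>X\<in>S. hits H X)"
  shows "\<exists>\<H>. finite \<H> \<and> (\<forall>H\<in>\<H>. hyperplane H) \<and> (\<forall>X\<in>F. \<exists>H\<in>\<H>. hits H X)"
proof (rule ccontr)
  assume "\<not> ?thesis"
  then have nhit: "\<not> finitely_hit F"
    by (simp add: finitely_hit_def)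
  have mem: "\<forall>X\<in>F. X \<noteq> {} \<and> convex X"
    using members by simp
  obtain P :: "((real ^ 'd) \<times> real) set" where P: "convex P" "0 \<notin> P"
      "\<forall>v. v \<noteq> 0 \<longrightarrow> v \<in> P \<or> - v \<in> P"
      and real: "\<forall>E. finite E \<longrightarrow> E \<subseteq> P \<longrightarrow> (\<exists>X\<in>F. \<forall>v\<in>E. positive_on v X)"
    using positive_cone_exists[OF mem nhit] by (elim exE conjE)
  \<comment> \<open>\<open>n\<close> is both the dimension of the space of affine functionals and
    the number of members hit at once, so the final linear system is square.\<close>
  define n where "n = CARD('d) + 1"
  have "dim (UNIV :: ((real ^ 'd) \<times> real) set) = n"
    by (simp add: n_def)
  then obtain u :: "nat \<Rightarrow> (real ^ 'd) \<times> real" where u: "\<And>i. i < n \<Longrightarrow> u i \<in> P"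
      "\<And>i \<epsilon>. Suc i < n \<Longrightarrow> 0 < \<epsilon> \<Longrightarrow> \<epsilon> *\<^sub>R u i - u (Suc i) \<in> P"
      and expand: "\<And>v. v = (\<Sum>i<n. (u i \<bullet> v) *\<^sub>R u i)"
    using lexicographic_basis[OF P(1,2) P(3)[rule_format], of UNIV n] by auto
  define g where "g i x = u i \<bullet> (x, 1)" for i and x :: "real ^ 'd"
  have n2: "2 \<le> n"
    by (simp add: n_def Suc_leI)
  \<comment> \<open>\<open>M\<close> bounds the ratios of coordinates in both directions. It depends
    on \<open>X\<close>, hence on \<open>\<epsilon>\<close>, so the next scale has to be chosen
    after it.\<close>
  define Q where "Q \<epsilon> X M \<longleftrightarrow> X \<in> F \<and> 1 \<le> M \<and> (\<forall>x\<in>X. (\<forall>i<n. 0 < g i x) \<and>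
      (\<forall>i. Suc i < n \<longrightarrow> g (Suc i) x \<le> \<epsilon> * g i x) \<and> (\<forall>i<n. \<forall>l<n. g l x \<le> M * g i x))"
    for \<epsilon> M X
  have "\<exists>X M. Q \<epsilon> X M" if \<epsilon>: "0 < \<epsilon>" for \<epsilon>
  proof -
    define E where "E = u ` {..<n} \<union> (\<lambda>i. \<epsilon> *\<^sub>R u i - u (Suc i)) ` {i. Suc i < n}"
    have "finite {i. Suc i < n}"
      by (rule finite_subset[of _ "{..<n}"]) auto
    then obtain X where X: "X \<in> F" "\<forall>v\<in>E. positive_on v X"
      using real[rule_format, of E] u \<epsilon> by (auto simp: E_def)
    have gpos: "0 < g i x" if "i < n" "x \<in> X" for i x
      using X(2) that by (auto simp: E_def positive_on_def g_def)
    have ratio: "g (Suc i) x \<le> \<epsilon> * g i x" if "Suc i < n" "x \<in> X" for i x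
    proof -
      have "positive_on (\<epsilon> *\<^sub>R u i - u (Suc i)) X"
        using X(2) that by (auto simp: E_def)
      then have "0 < (\<epsilon> *\<^sub>R u i - u (Suc i)) \<bullet> (x, 1)"
        using that by (simp only: positive_on_def)
      then show ?thesis
        by (simp only: g_def inner_diff_left inner_scaleR_left)
    qed
    have "continuous_on X (g i)" for i
      unfolding g_def by (intro continuous_intros)
    then obtain M where "1 \<le> M" "\<forall>x\<in>X. \<forall>i<n. \<forall>l<n. g l x \<le> M * g i x"
      using compact_ratio_bound[of X n g] members X gpos by blast
    then show ?thesis
      unfolding Q_def using X gpos ratio by blast
  qed
  then obtain X M where "\<And>\<epsilon>. 0 < \<epsilon> \<Longrightarrow> Q \<epsilon> (X \<epsilon>) (M \<epsilon>)"
    by metis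
  then have XM: "\<And>\<epsilon>. 0 < \<epsilon> \<Longrightarrow> X \<epsilon> \<in> F" "\<And>\<epsilon>. 0 < \<epsilon> \<Longrightarrow> 1 \<le> M \<epsilon>"
      "\<And>\<epsilon> x i. 0 < \<epsilon> \<Longrightarrow> x \<in> X \<epsilon> \<Longrightarrow> i < n \<Longrightarrow> 0 < g i x"
      "\<And>\<epsilon> x i. 0 < \<epsilon> \<Longrightarrow> x \<in> X \<epsilon> \<Longrightarrow> Suc i < n \<Longrightarrow> g (Suc i) x \<le> \<epsilon> * g i x"
      "\<And>\<epsilon> x i l. 0 < \<epsilon> \<Longrightarrow> x \<in> X \<epsilon> \<Longrightarrow> i < n \<Longrightarrow> l < n \<Longrightarrow> g l x \<le> M \<epsilon> * g i x"
    unfolding Q_def by blast+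
  \<comment> \<open>The recursion makes \<open>M (e j) * (2 * real n * e (Suc j))\<close> equal to
    \<open>e j\<close>, which closes the induction for \<open>small\<close>; the start value keeps
    \<open>2 * real n * e j\<close> at most 1/2.\<close>
  define e where "e = rec_nat (1 / (4 * real n)) (\<lambda>_ \<epsilon>. \<epsilon> / (2 * real n * M \<epsilon>))"
  have e0: "e 0 = 1 / (4 * real n)" and eSuc: "e (Suc j) = e j / (2 * real n * M (e j))" for j
    by (simp_all add: e_def)
  have epos: "0 < e j" for j
  proof (induction j)
    case (Suc j)
    then show ?case
      using n2 XM(2)[OF Suc] by (simp add: eSuc)
  qed (use n2 in \<open>simp add: e0\<close>)
  have Mpos: "1 \<le> M (e j)" for j
    by (intro XM(2) epos)
  have eM: "2 * real n * M (e j) * e (Suc j) = e j" for j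
    using Mpos[of j] n2 by (simp add: eSuc)
  have "e (Suc j) \<le> e j" for j
  proof -
    have "1 * 1 \<le> 2 * real n * M (e j)"
      using Mpos[of j] n2 by (intro mult_mono) auto
    then have "1 * e (Suc j) \<le> (2 * real n * M (e j)) * e (Suc j)"
      using epos[of "Suc j"] by (intro mult_right_mono) auto
    then show ?thesis
      using eM by simp
  qed
  then have "decseq e"
    by (rule decseq_SucI)
  then have emono: "e k \<le> e j" if "j \<le> k" for j k
    using that by (rule decseqD)
  have e_half: "2 * real n * e j \<le> 1 / 2" for j
    using emono[of 0 j] n2 by (simp add: e0 field_simps)
  have e_le1: "e j \<le> 1" for j
  proof -
    have "1 * e j \<le> 2 * real n * e j"
      using n2 epos[of j] by (intro mult_right_mono) auto
    then show ?thesis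
      using e_half[of j] by simp
  qed
  have neq: "X (e j) \<noteq> X (e k)" if "j < k" for j k
  proof
    \<comment> \<open>A common point would satisfy \<open>g 0 x \<le> M (e j) * e k * g 0 x\<close>,
      where the factor is at most \<open>e j / (2 * real n) < 1\<close>.\<close>
    assume eq: "X (e j) = X (e k)"
    obtain x where x: "x \<in> X (e j)"
      using members XM(1)[OF epos] by blast
    have pos: "0 < g 0 x"
      using XM(3)[OF epos x, of 0] n2 by simp
    have "g 0 x \<le> M (e j) * g 1 x"
      using XM(5)[OF epos x, of 1 0] n2 by simp
    also have "g 1 x \<le> e k * g 0 x"
      using XM(4)[of "e k" x 0] epos x eq n2 by simp
    also have "e k * g 0 x \<le> e (Suc j) * g 0 x"
      using emono[of "Suc j" k] that pos by (intro mult_right_mono) auto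
    finally have "g 0 x \<le> M (e j) * e (Suc j) * g 0 x"
      using Mpos[of j] by (simp add: mult.assoc)
    then have "1 \<le> M (e j) * e (Suc j)"
      using pos by simp
    then have "2 * real n * 1 \<le> 2 * real n * (M (e j) * e (Suc j))"
      by (intro mult_left_mono) auto
    also have "\<dots> = e j"
      using eM[of j] by (simp only: mult.assoc)
    finally show False
      using e_le1[of j] n2 by simp
  qed
  then have inj: "inj (\<lambda>j. X (e j))"
    by (metis injI linorder_neqE_nat)
  define G where "G = range (\<lambda>j. X (e j))"
  have "infinite G" "G \<subseteq> F"
    using inj range_inj_infinite XM(1) epos by (auto simp: G_def)
  then obtain S H where S: "S \<subseteq> G" "card S = n" "hyperplane H" "\<forall>X\<in>S. hits H X"
    unfolding n_def using aleph0 by blast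

  \<comment> \<open>The coefficients of a common hyperplane\<close>
  obtain a :: "(real ^ 'd) \<times> real" where a: "a \<noteq> 0" "H = {x. a \<bullet> (x, 1) = 0}"
    using hyperplane_as_zero_set[OF S(3)] .
  \<comment> \<open>These are the coordinates of \<open>a\<close> in the basis \<open>u\<close>;
    each point of \<open>H\<close> in a chosen member gives one linear relation among them.\<close>
  define \<alpha> where "\<alpha> i = u i \<bullet> a" for i
  have functional: "a \<bullet> (x, 1) = (\<Sum>i<n. \<alpha> i * g i x)" for x
    unfolding \<alpha>_def g_def by (subst expand[of a]) (simp only: inner_sum_left inner_scaleR_left)
  define A where "A = Max ((\<lambda>i. \<bar>\<alpha> i\<bar>) ` {..<n})"
  have A: "\<bar>\<alpha> i\<bar> \<le> A" if "i < n" for i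
    using that by (auto simp: A_def)
  have "A \<in> (\<lambda>i. \<bar>\<alpha> i\<bar>) ` {..<n}"
    unfolding A_def using n2 by (intro Max_in) (auto simp: lessThan_empty_iff)
  then obtain m where m: "m < n" "A = \<bar>\<alpha> m\<bar>"
    by blast
  have "0 < A"
  proof (rule ccontr)
    assume "\<not> 0 < A"
    then have "\<forall>i<n. \<alpha> i = 0"
      using A by fastforce
    then show False
      using expand[of a] a(1) by (simp add: \<alpha>_def)
  qed
  define J where "J = {j. X (e j) \<in> S}"
  have img: "(\<lambda>j. X (e j)) ` J = S"
    using S(1) by (auto simp: J_def G_def)
  have cardJ: "card J = n"
    using card_image[of "\<lambda>j. X (e j)" J] inj img S(2) by (metis inj_on_subset subset_UNIV)
  then have finJ: "finite J"
    using n2 card.infinite by fastforce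
  \<comment> \<open>\<open>c\<close> lists \<open>J\<close> in decreasing order, so
    \<open>\<alpha> 0\<close> is treated with the latest member. This is the antidiagonal.\<close>
  define c where "c i = sorted_list_of_set J ! (n - 1 - i)" for i
  have cJ: "c i \<in> J" if "i < n" for i
    using that cardJ finJ nth_mem[of "n - 1 - i" "sorted_list_of_set J"] by (simp add: c_def)
  have cless: "c i < c l" if "l < i" "i < n" for i l
    using that cardJ finJ strict_sorted_list_of_set[of J] unfolding c_def sorted_wrt_iff_nth_less
    by (simp add: diff_less_mono2)
  have small: "\<bar>\<alpha> i\<bar> \<le> 2 * real n * e (c i) * A" if "i < n" for i
    using that
  proof (induction i rule: less_induct)
    case (less i)
    let ?j = "c i"
    have "hits H (X (e ?j))"
      using cJ[OF less.prems] S(4) by (simp add: J_def)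
    then obtain x where x: "x \<in> X (e ?j)" "(\<Sum>l<n. \<alpha> l * g l x) = 0"
      by (auto simp: hits_def a(2) functional)
    have xpos: "0 < g l x" if "l < n" for l
      using XM(3) epos x(1) that by blast
    have dec: "g l x \<le> e ?j * g i x" if "i < l" "l < n" for l
      using geometric_decay[of n "\<lambda>l. g l x"] xpos XM(4)[OF epos x(1)] e_le1 that by blast
    have before: "\<bar>\<alpha> l\<bar> \<le> 2 * real n * e (Suc ?j) * A" if "l < i" for l
    proof -
      have "\<bar>\<alpha> l\<bar> \<le> 2 * real n * e (c l) * A"
        using less that by simp
      also have "\<dots> \<le> 2 * real n * e (Suc ?j) * A"
        using cless[OF that less.prems] emono[of "Suc ?j" "c l"] \<open>0 < A\<close>
        by (intro mult_right_mono mult_left_mono) auto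
      finally show ?thesis .
    qed
    \<comment> \<open>Here \<open>\<eta>'\<close> is \<open>2 * real n * e (Suc ?j)\<close>: earlier
      coefficients come from members later than \<open>?j\<close>, which compensates the factor
      \<open>M (e ?j)\<close>.\<close>
    have "\<bar>\<alpha> i\<bar> \<le> real n * (M (e ?j) * (2 * real n * e (Suc ?j)) + e ?j) * A"
      by (rule coefficient_bound[where y = "\<lambda>l. g l x"])
        (use x less.prems xpos before dec A XM(5)[OF epos x(1)] Mpos[of ?j] epos \<open>0 < A\<close>
          in \<open>auto simp: less_imp_le intro: order_trans[OF _ Mpos]\<close>)
    also have "M (e ?j) * (2 * real n * e (Suc ?j)) = e ?j"
      using eM[of ?j] by (simp add: ac_simps)
    finally show ?case
      by (simp add: algebra_simps)
  qed
  \<comment> \<open>At an index of maximal modulus the bound gives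
    \<open>A \<le> A / 2\<close>.\<close>
  have "A \<le> 2 * real n * e (c m) * A"
    using small m by simp
  also have "\<dots> \<le> 1 / 2 * A"
    using e_half[of "c m"] \<open>0 < A\<close> by (intro mult_right_mono) auto
  finally show False
    using \<open>0 < A\<close> by simp
qed

end
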